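(* Let $\Theta$ be a finite set, $1\le T\le\infty$, $\mu\in\operatorname{int}\Delta(\Theta)$ a prior, and $\beta=(\beta_t)_{t=1}^T$ a decreasing sequence ($\beta_1\ge\beta_2\ge\cdots$) of nonnegative reals with $0<\sum_{t=1}^T\beta_t<\infty$. Let $\xi:\Theta\to\Delta(Z)$ be a non-trivial static information structure with $Z$ finite, and let $H$ and $P$ be cdfs of random arrival times supported on $\{1,\dots,T\}$. Let $\pi_1$ (respectively $\pi_2$) be the dynamic information structure in which the realization of $\xi$ arrives at a random time with cdf $H$ (respectively $P$) and no other information arrives. If $P$ second-order stochastically dominates $H$, then $\pi_1$ dominates $\pi_2$ in the class of $\beta$-discounted problems, i.e. $W(\pi_1)\ge W(\pi_2)$ for every $\beta$-discounted problem with state space $\Theta$ and horizon $T$.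
   Context: Periods are $t\in\{1,\dots,T\}$ (all positive integers if $T=\infty$). $\Delta(X)$ denotes the probability measures on $X$. Let $\rho\in\Delta(\Delta(\Theta))$ be the (finitely supported) law of the posterior about $\theta$ after observing $z\sim\xi(\cdot\mid\theta)$ with $\theta\sim\mu$. Non-trivial means that $\rho$ is not the point mass $\delta_\mu$ at the prior. Random arrival: an arrival time $Y$ with values in $\{1,\dots,T\}$ and the given cdf is drawn independently of $(\theta,z)$. The agent observes $z$ in period $Y$ (before acting) and an uninformative null signal in every other period. The period-$t$ distribution over posteriors is the law of the belief about $\theta$ given everything observed in periods $1,\dots,t$; it is $F_t=H(t)\rho+(1-H(t))\delta_\mu$ under $\pi_1$ and $G_t=P(t)\rho+(1-P(t))\delta_\mu$ under $\pi_2$. $P$ second-order stochastically dominates $H$ means that a random variable with cdf $H$ is a mean-preserving spread of one with cdf $P$: there are random variables $Y_1$ with cdf $H$, $Y_2$ with cdf $P$, and an integrable $W$, on a common probability space, with $Y_1=Y_2+W$ and $\mathbb{E}[W\mid Y_2]=0$. $\beta$-discounted problem (for the given $\beta$): a nonempty compact action set $A^*$, available in every period, and a continuous $v:A^*\times\Theta\to\mathbb{R}$; the total utility is $\sum_{t=1}^T\beta_t v(a_t,\theta)$. Value of a signal: put $V(x)=\max_{a\in A^*}\sum_\theta x(\theta)v(a,\theta)$ for $x\in\Delta(\Theta)$. The agent's optimal ex ante expected utility is $W(\pi_1)=\sum_{t=1}^T\beta_t\,\mathbb{E}_{x\sim F_t}[V(x)]$ and $W(\pi_2)=\sum_{t=1}^T\beta_t\,\mathbb{E}_{x\sim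 G_t}[V(x)]$. *)

theory Defs
  imports "HOL-Probability.Probability" "HOL-Library.Extended_Nat"
begin

definition periods :: "enat \<Rightarrow> nat set" where
  "periods T = {t. 1 \<le> t \<and> enat t \<le> T}"

section \<open>Beliefs\<close>

definition joint_law :: "'s pmf \<Rightarrow> ('s \<Rightarrow> 'x pmf) \<Rightarrow> ('s \<times> 'x) pmf" where
  "joint_law \<mu> \<xi> = bind_pmf \<mu> (\<lambda>\<theta>. map_pmf (Pair \<theta>) (\<xi> \<theta>))"

text \<open>Meaningful only for signals of positive probability; \<^const>\<open>cond_pmf\<close> is
  unspecified otherwise.\<close>

definition posterior :: "'s pmf \<Rightarrow> ('s \<Rightarrow> 'x pmf) \<Rightarrow> 'x \<Rightarrow> 's pmf" where
  "posterior \<mu> \<xi> x = map_pmf fst (cond_pmf (joint_law \<mu> \<xi>) (snd -` {x}))"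

definition posterior_law :: "'s pmf \<Rightarrow> ('s \<Rightarrow> 'x pmf) \<Rightarrow> 's pmf pmf" where
  "posterior_law \<mu> \<xi> = map_pmf (posterior \<mu> \<xi>) (map_pmf snd (joint_law \<mu> \<xi>))"

definition nontrivial :: "'s pmf \<Rightarrow> ('s \<Rightarrow> 'x pmf) \<Rightarrow> bool" where
  "nontrivial \<mu> \<xi> \<longleftrightarrow> posterior_law \<mu> \<xi> \<noteq> return_pmf \<mu>"

section \<open>Dynamic information structures\<close>

text \<open>A dynamic information structure maps each state to the law of the whole signal path
  (coordinate \<open>t\<close> is the signal of period \<open>t\<close>; coordinate \<open>0\<close> and coordinates beyond the
  horizon are never used).  Path laws are taken to be discrete, which covers
  random arrival: there are only countably many possible paths.\<close>

type_synonym ('s, 'x) dynamic_info = "'s \<Rightarrow> (nat \<Rightarrow> 'x) pmf"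

definition history :: "nat \<Rightarrow> (nat \<Rightarrow> 'x) \<Rightarrow> 'x list" where
  "history t s = map s [1..<Suc t]"

definition belief_law :: "'s pmf \<Rightarrow> ('s, 'x) dynamic_info \<Rightarrow> nat \<Rightarrow> 's pmf pmf" where
  "belief_law \<mu> \<pi> t = posterior_law \<mu> (\<lambda>\<theta>. map_pmf (history t) (\<pi> \<theta>))"

text \<open>\<^const>\<open>None\<close> is the null signal. The arrival time has law \<open>\<tau>\<close> and is
  independent of the state and of the realization of \<open>\<xi>\<close>.\<close>

definition random_arrival :: "('s \<Rightarrow> 'z pmf) \<Rightarrow> nat pmf \<Rightarrow> ('s, 'z option) dynamic_info" where
  "random_arrival \<xi> \<tau> \<theta> =
     map_pmf (\<lambda>(y, z) t. if t = y then Some z else None) (pair_pmf \<tau> (\<xi> \<theta>))"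

section \<open>Second-order stochastic dominance\<close>

text \<open>\<open>second_order_dominates TYPE('w) P H\<close>: \<open>P\<close> dominates \<open>H\<close>, i.e. a random variable with
  cdf \<open>H\<close> is a mean-preserving spread of one with cdf \<open>P\<close>.  The type of the sample space is
  a parameter because HOL cannot quantify over types inside a formula; as a premise with
  \<open>'w\<close> free, it asks for such a coupling on some probability space of an arbitrary type.\<close>

definition second_order_dominates ::
    "'w itself \<Rightarrow> (real \<Rightarrow> real) \<Rightarrow> (real \<Rightarrow> real) \<Rightarrow> bool" where
  "second_order_dominates _ P H \<longleftrightarrow>
     (\<exists>(M :: 'w measure) Y1 Y2 W.
        prob_space M \<and>
        Y1 \<in> borel_measurable M \<and> cdf (distr M borel Y1) = H \<and>
        Y2 \<in> borel_measurable M \<and> cdf (distr M borel Y2) = P \<and>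
        integrable M W \<and>
        (AE \<omega> in M. Y1 \<omega> = Y2 \<omega> + W \<omega>) \<and>
        (AE \<omega> in M. real_cond_exp M (vimage_algebra (space M) Y2 borel) W \<omega> = 0))"

section \<open>Discounted problems and the value of information\<close>

text \<open>Since the finite state space is discrete, continuity of \<open>v\<close> on \<open>A \<times> \<Theta>\<close> is
  continuity on \<open>A\<close> for each state.\<close>

definition discounted_problem :: "'a::topological_space set \<Rightarrow> ('a \<Rightarrow> 's \<Rightarrow> real) \<Rightarrow> bool" where
  "discounted_problem A v \<longleftrightarrow>
     A \<noteq> {} \<and> compact A \<and> (\<forall>\<theta>. continuous_on A (\<lambda>a. v a \<theta>))"

text \<open>For a discounted problem the supremum is a maximum.\<close>

definition indirect_utility :: "'a set \<Rightarrow> ('a \<Rightarrow> 's::finite \<Rightarrow> real) \<Rightarrow> 's pmf \<Rightarrow> real" where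
  "indirect_utility A v x = (SUP a\<in>A. \<Sum>\<theta>\<in>UNIV. pmf x \<theta> * v a \<theta>)"

definition optimal_utility ::
    "enat \<Rightarrow> (nat \<Rightarrow> real) \<Rightarrow> 's::finite pmf \<Rightarrow> 'a set \<Rightarrow> ('a \<Rightarrow> 's \<Rightarrow> real) \<Rightarrow>
     ('s, 'x) dynamic_info \<Rightarrow> real" where
  "optimal_utility T \<beta> \<mu> A v \<pi> =
     (\<Sum>\<^sub>\<infinity>t\<in>periods T.
        \<beta> t * measure_pmf.expectation (belief_law \<mu> \<pi> t) (indirect_utility A v))"

end

theory Submission
  imports Defs
begin

text \<open>The period-\<open>t\<close> belief is the prior before the arrival and the posterior from \<open>\<xi>\<close> after it.
  Hence two arrival laws differ in value only by the value of \<open>\<xi>\<close>, which is nonnegative by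
  convexity of the indirect utility, times the difference of \<open>\<Sum>t. \<beta> t * Pr (Y \<le> t)\<close>. This sum is
  the total discount weight minus the expectation of \<open>C Y = (\<Sum>i<Y. \<beta> i)\<close>. As \<open>\<beta>\<close> is decreasing,
  \<open>C\<close> is concave, so a mean-preserving spread of \<open>Y\<close> lowers the expectation of \<open>C Y\<close>.\<close>

section \<open>Bayes' rule on a finite state space\<close>

lemma pmf_joint_law:
  fixes \<mu> :: "'s::finite pmf"
  shows "pmf (joint_law \<mu> \<xi>) (\<theta>, x) = pmf \<mu> \<theta> * pmf (\<xi> \<theta>) x"
proof -
  have fibre: "pmf (map_pmf (Pair \<theta>') (\<xi> \<theta>')) (\<theta>, x) = (if \<theta>' = \<theta> then pmf (\<xi> \<theta>) x else 0)" for \<theta>'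
  proof (cases "\<theta>' = \<theta>")
    case True
    then show ?thesis by (simp add: pmf_map_inj' inj_def)
  next
    case False
    then have "(\<theta>, x) \<notin> set_pmf (map_pmf (Pair \<theta>') (\<xi> \<theta>'))" by auto
    then show ?thesis using False by (simp only: pmf_eq_0_set_pmf simp_thms if_False)
  qed
  show ?thesis
    unfolding joint_law_def pmf_bind fibre
    by (subst integral_measure_pmf_real[where A = UNIV])
       (auto simp: if_distrib[of "\<lambda>c. c * _"] cong: if_cong)
qed

lemma map_snd_joint_law: "map_pmf snd (joint_law \<mu> \<xi>) = bind_pmf \<mu> \<xi>"
  by (simp add: joint_law_def map_bind_pmf map_pmf_comp)

lemma pmf_posterior:
  fixes \<mu> :: "'s::finite pmf"
  assumes "x \<in> set_pmf (bind_pmf \<mu> \<xi>)"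
  shows "pmf (posterior \<mu> \<xi> x) \<theta> = pmf \<mu> \<theta> * pmf (\<xi> \<theta>) x / pmf (bind_pmf \<mu> \<xi>) x"
proof -
  have ne: "set_pmf (joint_law \<mu> \<xi>) \<inter> snd -` {x} \<noteq> {}"
    using assms unfolding map_snd_joint_law[symmetric] by auto
  have "pmf (posterior \<mu> \<xi> x) \<theta> =
      measure_pmf.prob (cond_pmf (joint_law \<mu> \<xi>) (snd -` {x})) (fst -` {\<theta>})"
    by (simp add: posterior_def pmf_map)
  \<comment> \<open>The conditioned law lives on pairs whose second component is \<open>x\<close>,
    so the event of state \<open>\<theta>\<close> shrinks to one pair.\<close>
  also have "\<dots> = measure_pmf.prob (cond_pmf (joint_law \<mu> \<xi>) (snd -` {x})) {(\<theta>, x)}"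
    by (rule measure_pmf.finite_measure_eq_AE) (auto simp: AE_measure_pmf_iff set_cond_pmf[OF ne])
  also have "\<dots> = pmf (joint_law \<mu> \<xi>) (\<theta>, x) / measure_pmf.prob (joint_law \<mu> \<xi>) (snd -` {x})"
    by (simp add: measure_pmf_single pmf_cond[OF ne])
  also have "\<dots> = pmf \<mu> \<theta> * pmf (\<xi> \<theta>) x / pmf (bind_pmf \<mu> \<xi>) x"
    by (simp add: pmf_joint_law map_snd_joint_law[symmetric] pmf_map)
  finally show ?thesis .
qed

lemma pmf_bind_finite:
  fixes \<mu> :: "'s::finite pmf"
  shows "pmf (bind_pmf \<mu> \<xi>) x = (\<Sum>\<theta>\<in>UNIV. pmf \<mu> \<theta> * pmf (\<xi> \<theta>) x)"
  unfolding pmf_bind by (subst integral_measure_pmf_real[where A = UNIV]) (auto simp: mult.commute)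

text \<open>A likelihood factor common to all states cancels in Bayes' rule. It will be the
  probability of the arrival time, which is independent of the state.\<close>

lemma posterior_cong:
  fixes \<mu> :: "'s::finite pmf"
  assumes x: "x \<in> set_pmf (bind_pmf \<mu> \<xi>)"
    and c: "c \<noteq> 0" and lik: "\<And>\<theta>. pmf (\<xi>' \<theta>) x' = c * pmf (\<xi> \<theta>) x"
  shows "posterior \<mu> \<xi>' x' = posterior \<mu> \<xi> x"
proof -
  have eq: "pmf (bind_pmf \<mu> \<xi>') x' = c * pmf (bind_pmf \<mu> \<xi>) x"
    by (simp add: pmf_bind_finite lik sum_distrib_left algebra_simps)
  then have "x' \<in> set_pmf (bind_pmf \<mu> \<xi>')"
    using x c by (simp add: set_pmf_iff del: set_bind_pmf)
  then show ?thesis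
    using x c by (intro pmf_eqI) (simp add: pmf_posterior eq lik del: set_bind_pmf)
qed

text \<open>The common likelihood cancels and leaves the prior. This will apply to the history that
  consists of null signals only.\<close>

lemma posterior_uninformative:
  fixes \<mu> :: "'s::finite pmf"
  assumes c: "c \<noteq> 0" and const: "\<And>\<theta>. pmf (\<xi> \<theta>) x = c"
  shows "posterior \<mu> \<xi> x = \<mu>"
proof -
  have eq: "pmf (bind_pmf \<mu> \<xi>) x = c"
    using sum_pmf_eq_1[of UNIV \<mu>] by (simp add: pmf_bind_finite const flip: sum_distrib_right)
  then have "x \<in> set_pmf (bind_pmf \<mu> \<xi>)"
    using c by (simp add: set_pmf_iff del: set_bind_pmf)
  then show ?thesis
    using c by (intro pmf_eqI) (simp add: pmf_posterior eq const del: set_bind_pmf)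
qed

lemma posterior_law_eq: "posterior_law \<mu> \<xi> = map_pmf (posterior \<mu> \<xi>) (bind_pmf \<mu> \<xi>)"
  by (simp add: posterior_law_def map_snd_joint_law)

section \<open>Beliefs under random arrival\<close>

text \<open>A history either shows both the arrival time and the realization, or is entirely null.
  In the first case the arrival time contributes only a factor independent of the state; in the
  second the whole likelihood is independent of the state.\<close>

lemma belief_law_random_arrival:
  fixes \<mu> :: "'s::finite pmf" and \<xi> :: "'s \<Rightarrow> 'z pmf"
  shows "belief_law \<mu> (random_arrival \<xi> \<tau>) t =
    bind_pmf \<tau> (\<lambda>y. if y \<in> {1..t} then posterior_law \<mu> \<xi> else return_pmf \<mu>)"
proof -
  \<comment> \<open>\<open>h y z\<close> is the history up to \<open>t\<close> when \<open>z\<close>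
    arrives in period \<open>y\<close>; histories start in period 1, so arrival at
    \<open>y = 0\<close> leaves no trace.\<close>
  define h :: "nat \<Rightarrow> 'z \<Rightarrow> 'z option list"
    where "h = (\<lambda>y z. map (\<lambda>s. if s = y then Some z else None) [1..<Suc t])"
  define none :: "'z option list" where "none = map (\<lambda>s. None) [1..<Suc t]"
  define \<xi>' where "\<xi>' = (\<lambda>\<theta>. map_pmf (history t) (random_arrival \<xi> \<tau> \<theta>))"
  have \<xi>': "\<xi>' \<theta> = map_pmf (\<lambda>(y, z). h y z) (pair_pmf \<tau> (\<xi> \<theta>))" for \<theta>
    unfolding \<xi>'_def random_arrival_def map_pmf_comp
    by (rule map_pmf_cong) (auto simp: history_def h_def)
  have h_arrived: "h y' z' = h y z \<longleftrightarrow> y' = y \<and> z' = z" if "y \<in> {1..t}" for y z y' z'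
  proof
    assume "h y' z' = h y z"
    then have "\<forall>s\<in>{1..<Suc t}. (if s = y' then Some z' else None) = (if s = y then Some z else None)"
      unfolding h_def map_eq_conv set_upt .
    moreover have "y \<in> {1..<Suc t}" using that by auto
    ultimately have "(if y = y' then Some z' else None) = Some z" by (auto split: if_splits)
    then show "y' = y \<and> z' = z" by (auto split: if_splits)
  qed simp
  have h_none: "h y z = none \<longleftrightarrow> y \<notin> {1..t}" for y z
    unfolding h_def none_def map_eq_conv set_upt by auto
  have arrived: "pmf (\<xi>' \<theta>) (h y z) = pmf \<tau> y * pmf (\<xi> \<theta>) z" if "y \<in> {1..t}" for \<theta> y z
  proof -
    have "(\<lambda>(y, z). h y z) -` {h y z} = {(y, z)}" using h_arrived[OF that] by auto
    then show ?thesis by (simp add: \<xi>' pmf_map measure_pmf_single pmf_pair)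
  qed
  have null: "pmf (\<xi>' \<theta>) none = measure_pmf.prob \<tau> (- {1..t})" for \<theta>
  proof -
    have "(\<lambda>(y, z). h y z) -` {none} = fst -` (- {1..t})"
      by (auto simp: h_none eq_commute[of none] simp del: atLeastAtMost_iff)
    then have "pmf (\<xi>' \<theta>) none = measure_pmf.prob (map_pmf fst (pair_pmf \<tau> (\<xi> \<theta>))) (- {1..t})"
      by (simp add: \<xi>' pmf_map)
    then show ?thesis by (simp only: map_fst_pair_pmf)
  qed
  \<comment> \<open>By independence the arrival time can be drawn first, so the cases
    \<open>y \<in> {1..t}\<close> and \<open>y \<notin> {1..t}\<close> separate inside the
    bind.\<close>
  have law: "bind_pmf \<mu> \<xi>' = bind_pmf \<tau> (\<lambda>y. map_pmf (h y) (bind_pmf \<mu> \<xi>))"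
    unfolding \<xi>' pair_pmf_def
    by (simp add: map_bind_pmf map_pmf_def bind_assoc_pmf bind_return_pmf)
       (rule bind_commute_pmf)
  have "belief_law \<mu> (random_arrival \<xi> \<tau>) t =
      bind_pmf \<tau> (\<lambda>y. map_pmf (\<lambda>z. posterior \<mu> \<xi>' (h y z)) (bind_pmf \<mu> \<xi>))"
    unfolding belief_law_def \<xi>'_def[symmetric] posterior_law_eq law
    by (simp add: map_bind_pmf map_pmf_comp)
  also have "\<dots> = bind_pmf \<tau> (\<lambda>y. if y \<in> {1..t} then posterior_law \<mu> \<xi> else return_pmf \<mu>)"
  proof (rule bind_pmf_cong[OF refl])
    fix y assume y: "y \<in> set_pmf \<tau>"
    show "map_pmf (\<lambda>z. posterior \<mu> \<xi>' (h y z)) (bind_pmf \<mu> \<xi>) =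
        (if y \<in> {1..t} then posterior_law \<mu> \<xi> else return_pmf \<mu>)"
    proof (cases "y \<in> {1..t}")
      case True
      have "map_pmf (\<lambda>z. posterior \<mu> \<xi>' (h y z)) (bind_pmf \<mu> \<xi>) =
          map_pmf (posterior \<mu> \<xi>) (bind_pmf \<mu> \<xi>)"
      proof (rule map_pmf_cong[OF refl])
        fix z assume "z \<in> set_pmf (bind_pmf \<mu> \<xi>)"
        then show "posterior \<mu> \<xi>' (h y z) = posterior \<mu> \<xi> z"
          using y True by (intro posterior_cong[where c = "pmf \<tau> y"] arrived) (auto simp: set_pmf_iff)
      qed
      then show ?thesis using True by (simp add: posterior_law_eq)
    next
      case False
      then have "h y z = none" for z by (simp only: h_none not_False_eq_True)
      moreover have "posterior \<mu> \<xi>' none = \<mu>"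
      proof (rule posterior_uninformative[OF _ null])
        \<comment> \<open>The posterior is determined only at signals of positive probability; the
          current \<open>y\<close>, in the support and outside \<open>{1..t}\<close>, supplies
          this.\<close>
        show "measure_pmf.prob \<tau> (- {1..t}) \<noteq> 0"
          using y False by (intro measure_measure_pmf_not_zero) auto
      qed
      ultimately show ?thesis using False by (simp del: atLeastAtMost_iff)
    qed
  qed
  finally show ?thesis .
qed

lemma finite_set_posterior_law:
  fixes \<xi> :: "'s \<Rightarrow> 'z::finite pmf"
  shows "finite (set_pmf (posterior_law \<mu> \<xi>))"
  by (simp add: posterior_law_eq del: set_bind_pmf)

lemma expectation_belief_law_random_arrival:
  fixes \<mu> :: "'s::finite pmf" and \<xi> :: "'s \<Rightarrow> 'z::finite pmf" and f :: "'s pmf \<Rightarrow> real"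
  shows "measure_pmf.expectation (belief_law \<mu> (random_arrival \<xi> \<tau>) t) f =
    f \<mu> + measure_pmf.prob \<tau> {1..t} * (measure_pmf.expectation (posterior_law \<mu> \<xi>) f - f \<mu>)"
proof -
  \<comment> \<open>Only whether \<open>y\<close> lies in \<open>{1..t}\<close> matters. Passing to
    a Boolean turns the bind into a finite mixture even if \<open>\<tau>\<close> has infinite
    support.\<close>
  let ?q = "map_pmf (\<lambda>y. y \<in> {1..t}) \<tau>"
  let ?k = "\<lambda>c. if c then posterior_law \<mu> \<xi> else return_pmf \<mu>"
  have T: "pmf ?q True = measure_pmf.prob \<tau> {1..t}"
  proof -
    have "(\<lambda>y. y \<in> {1..t}) -` {True} = {1..t}"
      by (simp only: set_eq_iff vimage_eq singleton_iff simp_thms)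
    then show ?thesis by (simp only: pmf_map)
  qed
  have F: "pmf ?q False = 1 - pmf ?q True"
  proof -
    have "sum (pmf ?q) UNIV = 1" by (rule sum_pmf_eq_1) simp_all
    then show ?thesis by (simp add: UNIV_bool)
  qed
  have "belief_law \<mu> (random_arrival \<xi> \<tau>) t = bind_pmf ?q ?k"
    by (simp add: belief_law_random_arrival bind_map_pmf)
  then have "measure_pmf.expectation (belief_law \<mu> (random_arrival \<xi> \<tau>) t) f =
      (\<Sum>c\<in>UNIV. pmf ?q c *\<^sub>R measure_pmf.expectation (?k c) f)"
    by (simp only:) (rule pmf_expectation_bind; simp add: finite_set_posterior_law)
  also have "\<dots> = pmf ?q True * measure_pmf.expectation (posterior_law \<mu> \<xi>) f + pmf ?q False * f \<mu>"
    by (simp add: UNIV_bool)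
  finally show ?thesis
    unfolding F T by (simp add: algebra_simps)
qed

section \<open>The value of information\<close>

text \<open>Martingale property of beliefs: weighting a posterior by its signal probability recovers
  the joint probability, and likelihoods sum to one over signals.\<close>

lemma expectation_posterior_law:
  fixes \<mu> :: "'s::finite pmf" and \<xi> :: "'s \<Rightarrow> 'z::finite pmf"
  shows "measure_pmf.expectation (posterior_law \<mu> \<xi>) (\<lambda>x. pmf x \<theta>) = pmf \<mu> \<theta>"
proof -
  have "pmf (posterior \<mu> \<xi> z) \<theta> * pmf (bind_pmf \<mu> \<xi>) z = pmf \<mu> \<theta> * pmf (\<xi> \<theta>) z" for z
  proof (cases "z \<in> set_pmf (bind_pmf \<mu> \<xi>)")
    case True
    then show ?thesis by (simp add: pmf_posterior set_pmf_iff del: set_bind_pmf)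
  next
    \<comment> \<open>Here the posterior is unspecified, but its weight is zero, and so is the joint
      probability of \<open>\<theta>\<close> and \<open>z\<close>.\<close>
    case False
    then have "pmf (bind_pmf \<mu> \<xi>) z = 0" by (simp only: pmf_eq_0_set_pmf simp_thms)
    moreover from this have "pmf \<mu> \<theta> * pmf (\<xi> \<theta>) z = 0"
      unfolding pmf_bind_finite by (subst (asm) sum_nonneg_eq_0_iff) auto
    ultimately show ?thesis by simp
  qed
  then have "measure_pmf.expectation (posterior_law \<mu> \<xi>) (\<lambda>x. pmf x \<theta>) =
      (\<Sum>z\<in>UNIV. pmf \<mu> \<theta> * pmf (\<xi> \<theta>) z)"
    unfolding posterior_law_eq integral_map_pmf
    by (subst integral_measure_pmf_real[where A = UNIV]) auto
  then show ?thesis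
    using sum_pmf_eq_1[of UNIV "\<xi> \<theta>"] by (simp flip: sum_distrib_left)
qed

text \<open>Compactness and continuity bound the payoffs, which makes \<open>SUP\<close> a genuine
  upper bound.\<close>

lemma indirect_utility_upper:
  assumes "discounted_problem A v" and "a \<in> A"
  shows "(\<Sum>\<theta>\<in>UNIV. pmf x \<theta> * v a \<theta>) \<le> indirect_utility A v x"
  unfolding indirect_utility_def
proof (rule cSUP_upper[OF assms(2)])
  have "compact ((\<lambda>a. \<Sum>\<theta>\<in>UNIV. pmf x \<theta> * v a \<theta>) ` A)"
    using assms(1) unfolding discounted_problem_def
    by (intro compact_continuous_image continuous_intros) auto
  then show "bdd_above ((\<lambda>a. \<Sum>\<theta>\<in>UNIV. pmf x \<theta> * v a \<theta>) ` A)"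
    by (intro bounded_imp_bdd_above compact_imp_bounded)
qed

text \<open>Jensen's inequality for a supremum of linear functions: the payoff of a fixed action is
  linear in the belief, so its mean over posteriors is its value at the prior. The supremum over
  actions is taken last.\<close>

lemma value_of_information_nonneg:
  fixes \<mu> :: "'s::finite pmf" and \<xi> :: "'s \<Rightarrow> 'z::finite pmf"
  assumes "discounted_problem A v"
  shows "indirect_utility A v \<mu> \<le>
    measure_pmf.expectation (posterior_law \<mu> \<xi>) (indirect_utility A v)"
proof -
  note int = integrable_measure_pmf_finite[OF finite_set_posterior_law[of \<mu> \<xi>]]
  have "(\<Sum>\<theta>\<in>UNIV. pmf \<mu> \<theta> * v a \<theta>) \<le>
      measure_pmf.expectation (posterior_law \<mu> \<xi>) (indirect_utility A v)" if "a \<in> A" for a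
  proof -
    have "(\<Sum>\<theta>\<in>UNIV. pmf \<mu> \<theta> * v a \<theta>) =
        measure_pmf.expectation (posterior_law \<mu> \<xi>) (\<lambda>x. \<Sum>\<theta>\<in>UNIV. pmf x \<theta> * v a \<theta>)"
      by (simp add: Bochner_Integration.integral_sum int expectation_posterior_law)
    also have "\<dots> \<le> measure_pmf.expectation (posterior_law \<mu> \<xi>) (indirect_utility A v)"
      by (intro integral_mono int indirect_utility_upper[OF assms that])
    finally show ?thesis .
  qed
  moreover have "A \<noteq> {}" using assms by (simp add: discounted_problem_def)
  ultimately show ?thesis
    unfolding indirect_utility_def[of A v \<mu>] by (intro cSUP_least)
qed

section \<open>Concavity and mean-preserving spreads\<close>

text \<open>Partial sums of a decreasing sequence are concave, with supergradient \<open>b n\<close>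
  at \<open>n\<close>: increments to the right are at most \<open>b n\<close>, those to the left at
  least \<open>b n\<close>. Since \<open>m\<close> and \<open>n\<close> are positive,
  \<open>b 0\<close> is in neither group of increments.\<close>

lemma sum_lessThan_le_tangent:
  fixes b :: "nat \<Rightarrow> real"
  assumes b: "\<And>i j. 1 \<le> i \<Longrightarrow> i \<le> j \<Longrightarrow> b j \<le> b i" and "1 \<le> m" "1 \<le> n"
  shows "sum b {..<m} \<le> sum b {..<n} + b n * (real m - real n)"
proof (cases "n \<le> m")
  case True
  have "sum b {..<m} = sum b {..<n} + sum b {n..<m}"
    using True by (simp add: lessThan_atLeast0 sum.atLeastLessThan_concat)
  moreover have "sum b {n..<m} \<le> of_nat (card {n..<m}) * b n"
    using assms by (intro sum_bounded_above) auto
  ultimately show ?thesis using True by (simp add: of_nat_diff mult.commute)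
next
  case False
  have "sum b {..<n} = sum b {..<m} + sum b {m..<n}"
    using False by (simp add: lessThan_atLeast0 sum.atLeastLessThan_concat)
  moreover have "sum b {m..<n} \<ge> of_nat (card {m..<n}) * b n"
    using assms by (intro sum_bounded_below) auto
  ultimately show ?thesis using False by (simp add: of_nat_diff algebra_simps)
qed

text \<open>A Borel law on the reals is determined by its cdf. The pmf carries the full power set as
  sigma-algebra, so it is first pushed forward to \<open>borel\<close>.\<close>

lemma distr_eq_of_cdf_eq:
  fixes p :: "nat pmf"
  assumes M: "prob_space M" and Y: "Y \<in> borel_measurable M"
    and cdf: "cdf (distr M borel Y) = cdf (measure_pmf (map_pmf real p))"
  shows "distr M borel Y = distr (measure_pmf p) borel real"
proof (rule cdf_unique)
  show "real_distribution (distr M borel Y)"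
    using M Y by (simp add: prob_space.real_distribution_distr)
  show "real_distribution (distr (measure_pmf p) borel real)"
    by (intro prob_space.real_distribution_distr prob_space_measure_pmf) simp
  have "cdf (measure_pmf (map_pmf real p)) = cdf (distr (measure_pmf p) borel real)"
    by (auto simp: cdf_def measure_distr)
  then show "cdf (distr M borel Y) = cdf (distr (measure_pmf p) borel real)"
    using cdf by simp
qed

lemma expectation_of_cdf_eq:
  fixes p :: "nat pmf" and f :: "real \<Rightarrow> real"
  assumes "prob_space M" "Y \<in> borel_measurable M"
    and "cdf (distr M borel Y) = cdf (measure_pmf (map_pmf real p))"
    and "f \<in> borel_measurable borel"
  shows "(LINT \<omega>|M. f (Y \<omega>)) = measure_pmf.expectation p (\<lambda>n. f (real n))"
proof -
  have "(LINT \<omega>|M. f (Y \<omega>)) = (LINT x|distr M borel Y. f x)"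
    by (rule integral_distr[symmetric]) (fact assms)+
  also have "\<dots> = (LINT x|distr (measure_pmf p) borel real. f x)"
    by (simp only: distr_eq_of_cdf_eq[OF assms(1-3)])
  also have "\<dots> = measure_pmf.expectation p (\<lambda>n. f (real n))"
    by (rule integral_distr) (simp_all add: assms(4))
  finally show ?thesis .
qed

text \<open>The support is countable, hence Borel. This lets inequalities for natural numbers be
  applied pointwise to a real-valued coupling.\<close>

lemma AE_of_cdf_eq:
  fixes p :: "nat pmf"
  assumes "prob_space M" "Y \<in> borel_measurable M"
    and "cdf (distr M borel Y) = cdf (measure_pmf (map_pmf real p))"
  shows "AE \<omega> in M. Y \<omega> \<in> real ` set_pmf p"
proof -
  have meas: "{x \<in> space borel. x \<in> real ` set_pmf p} \<in> sets borel"
    by (simp add: borel_singleton sets.countable countable_set_pmf)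
  have "AE x in distr (measure_pmf p) borel real. x \<in> real ` set_pmf p"
    using meas by (subst AE_distr_iff) (auto simp: AE_measure_pmf_iff)
  then show ?thesis
    using assms(2) meas unfolding distr_eq_of_cdf_eq[OF assms, symmetric]
    by (subst (asm) AE_distr_iff) auto
qed

text \<open>The tangent inequality at \<open>Y\<^sub>2\<close> involves only \<open>W\<close>, weighted by the bounded slope
  \<open>b Y\<^sub>2\<close>; hence the arrival times need not be integrable.\<close>

lemma expectation_sum_lessThan_mono:
  fixes b :: "nat \<Rightarrow> real" and p q :: "nat pmf"
  assumes b: "\<And>i j. 1 \<le> i \<Longrightarrow> i \<le> j \<Longrightarrow> b j \<le> b i" and nonneg: "\<And>i. 0 \<le> b i"
    and summable: "summable b"
    and p: "0 \<notin> set_pmf p" and q: "0 \<notin> set_pmf q"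
    and dom: "second_order_dominates TYPE('w) (cdf (measure_pmf (map_pmf real q)))
                (cdf (measure_pmf (map_pmf real p)))"
  shows "measure_pmf.expectation p (\<lambda>n. sum b {..<n}) \<le> measure_pmf.expectation q (\<lambda>n. sum b {..<n})"
proof -
  obtain M :: "'w measure" and Y1 Y2 W where
    M: "prob_space M"
    and Y1[measurable]: "Y1 \<in> borel_measurable M" and c1: "cdf (distr M borel Y1) = cdf (measure_pmf (map_pmf real p))"
    and Y2[measurable]: "Y2 \<in> borel_measurable M" and c2: "cdf (distr M borel Y2) = cdf (measure_pmf (map_pmf real q))"
    and W: "integrable M W" and sum: "AE \<omega> in M. Y1 \<omega> = Y2 \<omega> + W \<omega>"
    and mart: "AE \<omega> in M. real_cond_exp M (vimage_algebra (space M) Y2 borel) W \<omega> = 0"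
    using dom unfolding second_order_dominates_def by blast
  interpret prob_space M by (rule M)
  \<comment> \<open>The sigma-algebra generated by \<open>Y2\<close>, on which the mean-zero
    condition is stated.\<close>
  define F where "F = vimage_algebra (space M) Y2 borel"
  have Y2F: "Y2 \<in> borel_measurable F"
    unfolding F_def by (rule measurable_vimage_algebra1) simp
  have "subalgebra M F"
    unfolding subalgebra_def F_def by (auto simp: sets_vimage_algebra2 intro: measurable_sets)
  then interpret F: finite_measure_subalgebra M F by unfold_locales
  \<comment> \<open>\<open>C\<close> and \<open>g\<close> extend the partial sums and their slopes
    to the reals as step functions. Both lie between 0 and \<open>suminf b\<close>, which gives all
    the integrability below.\<close>
  define C where "C = (\<lambda>x::real. sum b {..<nat \<lfloor>x\<rfloor>})"
  define g where "g = (\<lambda>x::real. b (nat \<lfloor>x\<rfloor>))"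
  have [measurable]: "C \<in> borel_measurable borel" "g \<in> borel_measurable borel"
    unfolding C_def g_def by measurable
  have C_nonneg: "0 \<le> C x" for x by (simp add: C_def sum_nonneg nonneg)
  have C_le: "C x \<le> suminf b" for x
    unfolding C_def by (rule sum_le_suminf) (auto simp: summable nonneg)
  have g_nonneg: "0 \<le> g x" for x by (simp add: g_def nonneg)
  have g_le: "g x \<le> suminf b" for x
    unfolding g_def using sum_le_suminf[OF summable, of "{nat \<lfloor>x\<rfloor>}"] by (simp add: nonneg)
  have intC: "integrable M (\<lambda>\<omega>. C (Y \<omega>))" if [measurable]: "Y \<in> borel_measurable M" for Y
    by (rule integrable_const_bound[where B = "suminf b"]) (auto simp: C_nonneg C_le)
  have intgW: "integrable M (\<lambda>\<omega>. g (Y2 \<omega>) * W \<omega>)"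
  proof (rule Bochner_Integration.integrable_bound)
    show "integrable M (\<lambda>\<omega>. suminf b * W \<omega>)" using W by simp
    show "(\<lambda>\<omega>. g (Y2 \<omega>) * W \<omega>) \<in> borel_measurable M" using W by measurable
    show "AE \<omega> in M. norm (g (Y2 \<omega>) * W \<omega>) \<le> norm (suminf b * W \<omega>)"
      using g_nonneg g_le by (auto simp: abs_mult intro!: mult_right_mono order_trans[OF g_le abs_ge_self])
  qed
  \<comment> \<open>\<open>g (Y2 \<omega>)\<close> is measurable for \<open>F\<close>, so
    conditioning on \<open>Y2\<close> acts on \<open>W\<close> alone.\<close>
  have "(LINT \<omega>|M. g (Y2 \<omega>) * W \<omega>) = (LINT \<omega>|M. g (Y2 \<omega>) * real_cond_exp M F W \<omega>)"
    using W by (intro F.real_cond_exp_intg(2)[symmetric] intgW measurable_compose[OF Y2F]) auto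
  also have "\<dots> = 0"
    using mart unfolding F_def[symmetric] by (intro integral_eq_zero_AE) auto
  finally have gW: "(LINT \<omega>|M. g (Y2 \<omega>) * W \<omega>) = 0" .
  have "AE \<omega> in M. C (Y1 \<omega>) \<le> C (Y2 \<omega>) + g (Y2 \<omega>) * W \<omega>"
    using AE_of_cdf_eq[OF M Y1 c1] AE_of_cdf_eq[OF M Y2 c2] sum
  proof eventually_elim
    case (elim \<omega>)
    obtain m where m: "m \<in> set_pmf p" "Y1 \<omega> = real m" using elim by auto
    obtain n where n: "n \<in> set_pmf q" "Y2 \<omega> = real n" using elim by auto
    have "1 \<le> m" "1 \<le> n" using m n p q by (metis less_one not_le)+
    then have "sum b {..<m} \<le> sum b {..<n} + b n * (real m - real n)"
      by (intro sum_lessThan_le_tangent b)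
    moreover have "W \<omega> = real m - real n" using elim m n by simp
    ultimately show ?case by (simp add: C_def g_def m n)
  qed
  then have "(LINT \<omega>|M. C (Y1 \<omega>)) \<le> (LINT \<omega>|M. C (Y2 \<omega>) + g (Y2 \<omega>) * W \<omega>)"
    by (intro integral_mono_AE intC intgW Bochner_Integration.integrable_add Y1 Y2)
  also have "\<dots> = (LINT \<omega>|M. C (Y2 \<omega>))"
    using intC[OF Y2] intgW by (simp add: gW)
  finally have "(LINT \<omega>|M. C (Y1 \<omega>)) \<le> (LINT \<omega>|M. C (Y2 \<omega>))" .
  then have "measure_pmf.expectation p (\<lambda>n. C (real n)) \<le> measure_pmf.expectation q (\<lambda>n. C (real n))"
    by (simp add: expectation_of_cdf_eq[OF M Y1 c1] expectation_of_cdf_eq[OF M Y2 c2])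
  then show ?thesis by (simp add: C_def)
qed

section \<open>Discounted sums of arrival probabilities\<close>

text \<open>Sum and expectation are exchanged, as the terms are dominated by \<open>b t\<close>. For
  arrival at \<open>n\<close> the remaining weight is the tail from \<open>n\<close> on, including
  \<open>n\<close> because the signal precedes the action; hence the strict bound in
  \<open>{..<n}\<close>.\<close>

lemma suminf_mult_prob_atMost:
  fixes b :: "nat \<Rightarrow> real" and p :: "nat pmf"
  assumes nonneg: "\<And>i. 0 \<le> b i" and summable: "summable b"
  shows "(\<Sum>t. b t * measure_pmf.prob p {..t}) =
    suminf b - measure_pmf.expectation p (\<lambda>n. sum b {..<n})"
proof -
  have eq: "(\<Sum>t. b t * indicator {..t} n) = suminf b - sum b {..<n}" for n :: nat
  proof -
    have s: "summable (\<lambda>t. b t * indicator {..t} n)"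
      by (rule summable_comparison_test[OF _ summable]) (auto simp: nonneg indicator_def)
    have "(\<Sum>t. b t * indicator {..t} n) = (\<Sum>t. b (t + n))"
      by (subst suminf_split_initial_segment[OF s, of n]) (simp add: indicator_def)
    then show ?thesis by (simp add: suminf_minus_initial_segment[OF summable])
  qed
  have "(\<Sum>t. b t * measure_pmf.prob p {..t}) =
      (\<Sum>t. measure_pmf.expectation p (\<lambda>n. b t * indicator {..t} n))"
    by simp
  also have "\<dots> = measure_pmf.expectation p (\<lambda>n. \<Sum>t. b t * indicator {..t} n)"
  proof (rule integral_suminf[symmetric])
    show "AE n in measure_pmf p. summable (\<lambda>t. norm (b t * indicator {..t} n))"
      by (intro AE_I2 summable_comparison_test[OF _ summable]) (auto simp: nonneg indicator_def)
    show "summable (\<lambda>t. measure_pmf.expectation p (\<lambda>n. norm (b t * indicator {..t} n)))"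
      by (intro summable_comparison_test[OF _ summable])
         (auto simp: nonneg abs_mult mult_left_le)
    show "integrable (measure_pmf p) (\<lambda>n. b t * indicator {..t} n)" for t
      by (intro integrable_mult_right) (simp add: integrable_indicator_iff less_top[symmetric])
  qed
  also have "\<dots> = suminf b - measure_pmf.expectation p (\<lambda>n. sum b {..<n})"
  proof -
    have "integrable (measure_pmf p) (\<lambda>n. sum b {..<n})"
      by (rule measure_pmf.integrable_const_bound[where B = "suminf b"])
         (auto simp: nonneg sum_nonneg summable intro!: sum_le_suminf)
    then show ?thesis by (simp add: eq)
  qed
  finally show ?thesis .
qed

section \<open>Comparison of the two arrival laws\<close>

theorem corollary4p5:
  fixes T :: enat
    and \<mu> :: "'s::finite pmf"
    and \<beta> :: "nat \<Rightarrow> real"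
    and \<xi> :: "'s \<Rightarrow> 'z::finite pmf"
    and H P :: "real \<Rightarrow> real"
    and \<tau>\<^sub>1 \<tau>\<^sub>2 :: "nat pmf"
  assumes "1 \<le> T"
    and "set_pmf \<mu> = UNIV"
    and "antimono_on (periods T) \<beta>"
    and "\<forall>t\<in>periods T. 0 \<le> \<beta> t"
    and "\<beta> summable_on periods T"
    and "0 < (\<Sum>\<^sub>\<infinity>t\<in>periods T. \<beta> t)"
    and "nontrivial \<mu> \<xi>"
    and "set_pmf \<tau>\<^sub>1 \<subseteq> periods T" and "H = cdf (measure_pmf (map_pmf real \<tau>\<^sub>1))"
    and "set_pmf \<tau>\<^sub>2 \<subseteq> periods T" and "P = cdf (measure_pmf (map_pmf real \<tau>\<^sub>2))"
    and "second_order_dominates TYPE('w) P H"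
  shows "\<forall>(A :: 'a::topological_space set) v. discounted_problem A v \<longrightarrow>
           optimal_utility T \<beta> \<mu> A v (random_arrival \<xi> \<tau>\<^sub>1) \<ge>
           optimal_utility T \<beta> \<mu> A v (random_arrival \<xi> \<tau>\<^sub>2)"
proof (intro allI impI)
  fix A :: "'a set" and v :: "'a \<Rightarrow> 's \<Rightarrow> real"
  assume problem: "discounted_problem A v"
  let ?V = "indirect_utility A v"
  define gain where "gain = measure_pmf.expectation (posterior_law \<mu> \<xi>) ?V - ?V \<mu>"
  \<comment> \<open>Extension by zero treats finite and infinite horizons alike. Also
    \<open>b 0 = 0\<close>, so \<open>b\<close> decreases only from index 1 on.\<close>
  define b where "b = (\<lambda>t. if t \<in> periods T then \<beta> t else 0)"
  have nonneg: "0 \<le> b t" for t using assms(4) by (simp add: b_def)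
  have mono: "b j \<le> b i" if "1 \<le> i" "i \<le> j" for i j
  proof (cases "j \<in> periods T")
    case True
    then have "i \<in> periods T"
      using that by (auto simp: periods_def intro: order_trans[of "enat i" "enat j"])
    then show ?thesis
      using True that assms(3) by (simp add: b_def monotone_on_def)
  qed (simp add: b_def assms(4))
  have "b summable_on UNIV"
    using assms(5) by (subst summable_on_cong_neutral[of "periods T" UNIV \<beta>]) (auto simp: b_def)
  then have summable: "summable b" by (rule summable_on_imp_summable)
  \<comment> \<open>The arrival law enters only through one expectation, whose coefficient is
    \<open>- gain\<close>.\<close>
  have utility: "optimal_utility T \<beta> \<mu> A v (random_arrival \<xi> \<tau>) =
      ?V \<mu> * suminf b + gain * (suminf b - measure_pmf.expectation \<tau> (\<lambda>n. sum b {..<n}))"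
    if \<tau>: "set_pmf \<tau> \<subseteq> periods T" for \<tau>
  proof -
    \<comment> \<open>Period 0 is outside \<open>periods T\<close> and carries no mass.\<close>
    have prob: "measure_pmf.prob \<tau> {1..t} = measure_pmf.prob \<tau> {..t}" for t
      using \<tau> by (intro measure_pmf.finite_measure_eq_AE) (auto simp: AE_measure_pmf_iff periods_def)
    have s1: "summable (\<lambda>t. b t * measure_pmf.prob \<tau> {..t})"
      by (rule summable_comparison_test[OF _ summable]) (auto simp: nonneg abs_mult mult_left_le)
    \<comment> \<open>\<open>optimal_utility\<close> is an unordered sum; absolute convergence
      identifies it with the ordered series.\<close>
    have s2: "summable (\<lambda>t. norm (b t * (?V \<mu> + measure_pmf.prob \<tau> {..t} * gain)))"
    proof (rule summable_comparison_test)
      show "summable (\<lambda>t. b t * (\<bar>?V \<mu>\<bar> + \<bar>gain\<bar>))" using summable by (rule summable_mult2)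
      have "\<bar>?V \<mu> + measure_pmf.prob \<tau> {..t} * gain\<bar> \<le> \<bar>?V \<mu>\<bar> + \<bar>gain\<bar>" for t
        by (rule order_trans[OF abs_triangle_ineq]) (simp add: abs_mult mult_left_le_one_le)
      then show "\<exists>N. \<forall>t\<ge>N. norm (norm (b t * (?V \<mu> + measure_pmf.prob \<tau> {..t} * gain)))
          \<le> b t * (\<bar>?V \<mu>\<bar> + \<bar>gain\<bar>)"
        by (auto simp: abs_mult nonneg intro!: mult_left_mono)
    qed
    have "optimal_utility T \<beta> \<mu> A v (random_arrival \<xi> \<tau>) =
        (\<Sum>\<^sub>\<infinity>t. b t * (?V \<mu> + measure_pmf.prob \<tau> {..t} * gain))"
      unfolding optimal_utility_def
      by (rule infsum_cong_neutral)
         (auto simp: b_def expectation_belief_law_random_arrival prob[simplified] gain_def)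
    also have "\<dots> = (\<Sum>t. b t * (?V \<mu> + measure_pmf.prob \<tau> {..t} * gain))"
      by (intro infsumI norm_summable_imp_has_sum s2 summable_sums summable_norm_cancel[OF s2])
    also have "\<dots> = (\<Sum>t. ?V \<mu> * b t + gain * (b t * measure_pmf.prob \<tau> {..t}))"
      by (simp add: algebra_simps)
    also have "\<dots> = ?V \<mu> * suminf b + gain * (\<Sum>t. b t * measure_pmf.prob \<tau> {..t})"
      using summable s1 by (simp add: suminf_add[symmetric] suminf_mult summable_mult)
    finally show ?thesis by (simp add: suminf_mult_prob_atMost nonneg summable)
  qed
  \<comment> \<open>With \<open>gain\<close> nonnegative, the smaller expectation of partial sums
    under \<open>\<tau>\<^sub>1\<close> yields the larger utility.\<close>
  have "0 \<le> gain" using value_of_information_nonneg[OF problem] by (simp add: gain_def)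
  moreover have "measure_pmf.expectation \<tau>\<^sub>1 (\<lambda>n. sum b {..<n}) \<le> measure_pmf.expectation \<tau>\<^sub>2 (\<lambda>n. sum b {..<n})"
    using assms(8,10,12) unfolding assms(9,11)
    by (intro expectation_sum_lessThan_mono[where 'w = 'w] mono nonneg summable) (auto simp: periods_def)
  ultimately show "optimal_utility T \<beta> \<mu> A v (random_arrival \<xi> \<tau>\<^sub>1) \<ge>
      optimal_utility T \<beta> \<mu> A v (random_arrival \<xi> \<tau>\<^sub>2)"
    by (simp add: utility assms(8,10) mult_left_mono)
qed

end
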